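(* Let $P$ be the lazy random walk transition matrix of a finite weighted graph $G=(V,E)$ with $n=|V|$ vertices, with columns $P_i$, $i\in V$. Let $K$ be an integer with $1\le K\le n$, let $0<\kappa\le 1$, and let $C:V\to\mathbb{R}_{+}$ be a cost function with $C(S)=\sum_{v\in S}C(v)$ for $S\subseteq V$. Let $C^{K}_{\max}$ be the sum of the $K$ largest values of $C$ on $V$, assumed positive. For $w\in\mathbb{R}^V$ put $P(w)=\sum_{i\in V} w_i\frac{P_i}{\|P_i\|_2}$ and $S(w)=\{i\in V: w_i>0\}$, and put $P^*=\frac{1}{\sqrt n}\mathbf{1}$. Let $$\mathcal{F}=\{w\in\mathbb{R}^V:\ w_i\ge 0\ \text{for all } i\in V,\ |S(w)|\le K,\ \|P(w)\|_2=1\}.$$ Suppose $$0\le\lambda\le\frac{1-\kappa}{C^{K}_{\max}\,\bigl(\min_{i\in V}\|P_i\|_2\bigr)\sqrt n},$$ and let $w^*$ be a solution of the problem of maximizing $P(w)^TP^*-\lambda\, C(S(w))$ over $w\in\mathcal{F}$. Then $$P(w^* )^TP^*\ \ge\ \kappa\max_{w\in\mathcal{F}}P(w)^TP^*.$$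
   Context: The lazy random walk transition matrix of a finite graph $G=(V,E)$ with (weighted) symmetric adjacency matrix $A$, $A_{ij}=A_{ji}\ge 0$, is $P=\frac{1}{d_{\max}}(A-D)+I$, where $D$ is the diagonal matrix with $D_{ii}=\sum_jA_{ij}$, $d_{\max}=\max_iD_{ii}>0$, and $I$ is the identity matrix. Thus $P$ is a symmetric matrix with nonnegative entries whose rows and columns sum to $1$. $\mathbf{1}$ denotes the all-ones vector in $\mathbb{R}^V$. *)

theory Defs
  imports "HOL-Analysis.Analysis" "HOL-Library.Multiset"
begin

text \<open>
  A finite weighted graph is given by its weighted adjacency matrix \<^term>\<open>A :: real^'n^'n\<close>;
  the vertex set is the finite index type \<^typ>\<open>'n\<close>, so the number of vertices is
  \<^term>\<open>CARD('n)\<close>. The norm on \<^typ>\<open>real^'n\<close> is the Euclidean norm.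
\<close>

definition degree_matrix :: "real^'n^'n \<Rightarrow> real^'n^'n" where
  "degree_matrix A = (\<chi> i j. if i = j then \<Sum>k\<in>UNIV. A $ i $ k else 0)"

definition max_degree :: "real^'n^'n \<Rightarrow> real" where
  "max_degree A = Max (range (\<lambda>i. degree_matrix A $ i $ i))"

definition lazy_walk :: "real^'n^'n \<Rightarrow> real^'n^'n" where
  "lazy_walk A = (1 / max_degree A) *\<^sub>R (A - degree_matrix A) + mat 1"

definition normalized_comb :: "real^'n^'n \<Rightarrow> real^'n \<Rightarrow> real^'n" where
  "normalized_comb P w = (\<Sum>i\<in>UNIV. w $ i *\<^sub>R (column i P /\<^sub>R norm (column i P)))"

definition pos_support :: "real^'n \<Rightarrow> 'n set" where
  "pos_support w = {i. w $ i > 0}"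

definition uniform_target :: "real^'n" where
  "uniform_target = (1 / sqrt (real CARD('n))) *\<^sub>R (\<chi> i. 1)"

definition feasible :: "real^'n^'n \<Rightarrow> nat \<Rightarrow> (real^'n) set" where
  "feasible P K =
    {w. (\<forall>i. w $ i \<ge> 0) \<and> card (pos_support w) \<le> K \<and> norm (normalized_comb P w) = 1}"

text \<open>Values of the cost function are counted with multiplicity, once for each vertex.\<close>

definition sum_largest :: "nat \<Rightarrow> ('n::finite \<Rightarrow> real) \<Rightarrow> real" where
  "sum_largest K C =
    sum_list (take K (rev (sorted_list_of_multiset (image_mset C (mset_set UNIV)))))"

end

theory Submission
  imports Defs
begin

text \<open>
  The columns of \<^term>\<open>P\<close> sum to 1, so the objective is the linear form that sends \<^term>\<open>w\<close> to the
  sum of the numbers \<open>w_i / (\<parallel>P_i\<parallel> \<surd>n)\<close>. By Cauchy-Schwarz it is at most 1 on the feasible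
  set, which is therefore compact. The unit coordinate vector at the column of least norm is
  feasible, hence the maximum \<open>M\<close> is at least \<open>1 / (min \<parallel>P_i\<parallel> \<surd>n)\<close>. The penalty of any feasible
  point is at most \<open>\<lambda> C^K_max \<le> (1 - \<kappa>) / (min \<parallel>P_i\<parallel> \<surd>n) \<le> (1 - \<kappa>) M\<close>, so the penalised
  optimum loses at most \<open>(1 - \<kappa>) M\<close>.
\<close>

text \<open>Greedy exchange along a descending list: each step pairs the head with one element of
  \<open>N\<close> that is no larger. Nonnegativity matters once \<open>N\<close> is exhausted while
  \<open>take K xs\<close> still has entries left.\<close>

lemma sum_mset_le_sum_list_take:
  fixes xs :: "real list"
  assumes "sorted_wrt (\<ge>) xs" "\<And>x. x \<in> set xs \<Longrightarrow> x \<ge> 0" "N \<subseteq># mset xs" "size N \<le> K"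
  shows "sum_mset N \<le> sum_list (take K xs)"
  using assms
proof (induction xs arbitrary: N K)
  case Nil
  then show ?case by simp
next
  case (Cons x xs)
  show ?case
  proof (cases "N = {#}")
    case True
    have "sum_list (take K (x # xs)) \<ge> 0"
      using Cons.prems(2) by (intro sum_list_nonneg) (meson in_set_takeD)
    then show ?thesis using True by simp
  next
    case False
    then obtain k where k: "K = Suc k" using Cons.prems(4) by (cases K) auto
    \<comment> \<open>Taking \<open>y = x\<close> whenever \<open>x\<close> occurs in
      \<open>N\<close> ensures that the rest of \<open>N\<close> fits into the tail; if
      \<open>x\<close> does not occur, \<open>N\<close> already lies in the tail and any
      \<open>y\<close> will do.\<close>
    obtain y where y: "y \<in># N" "x \<in># N \<Longrightarrow> y = x" using False by (cases "x \<in># N") auto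
    have "N - {#x#} \<subseteq># mset xs"
      using Cons.prems(3) by (simp add: subset_eq_diff_conv)
    then have sub: "N - {#y#} \<subseteq># mset xs"
      using y(2) by (cases "x \<in># N") (auto simp: diff_single_trivial intro: subset_mset.trans[OF diff_subset_eq_self])
    have "y \<in># mset (x # xs)" using mset_subset_eqD[OF Cons.prems(3) y(1)] .
    then have "y \<le> x" using Cons.prems(1) by auto
    moreover have "sum_mset (N - {#y#}) \<le> sum_list (take k xs)"
    proof (rule Cons.IH)
      show "sorted_wrt (\<ge>) xs" using Cons.prems(1) by simp
      show "z \<ge> 0" if "z \<in> set xs" for z using Cons.prems(2) that by simp
      show "size (N - {#y#}) \<le> k" using Cons.prems(4) y(1) k by (simp add: size_Diff_singleton)
    qed (rule sub)
    moreover have "sum_mset N = y + sum_mset (N - {#y#})"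
      using sum_mset.remove[OF y(1)] .
    ultimately show ?thesis by (simp add: k)
  qed
qed

text \<open>Passing to multisets of values keeps equal costs at distinct vertices apart, so the
  greedy bound applies to the costs on \<open>S\<close>.\<close>

lemma sum_le_sum_largest:
  fixes C :: "'n::finite \<Rightarrow> real"
  assumes "\<And>v. C v \<ge> 0" "card S \<le> K"
  shows "sum C S \<le> sum_largest K C"
proof -
  let ?xs = "rev (sorted_list_of_multiset (image_mset C (mset_set UNIV)))"
  have "sum_mset (image_mset C (mset_set S)) \<le> sum_list (take K ?xs)"
  proof (rule sum_mset_le_sum_list_take)
    show "sorted_wrt (\<ge>) ?xs" by (simp add: sorted_wrt_rev)
    show "image_mset C (mset_set S) \<subseteq># mset ?xs"
      by (simp add: image_mset_subseteq_mono subset_imp_msubset_mset_set)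
  qed (use assms in auto)
  then show ?thesis by (simp add: sum_largest_def sum_unfold_sum_mset)
qed

text \<open>By symmetry the column sums of \<open>A\<close> are the degrees, so
  \<open>A - degree_matrix A\<close> contributes 0 to each column and only the identity
  remains.\<close>

lemma lazy_walk_column_sum:
  fixes A :: "real^'n^'n"
  assumes "\<And>i j. A $ i $ j = A $ j $ i"
  shows "(\<Sum>j\<in>UNIV. lazy_walk A $ j $ i) = 1"
proof -
  have "(\<Sum>j\<in>UNIV. degree_matrix A $ j $ i) = (\<Sum>k\<in>UNIV. A $ i $ k)"
    by (simp add: degree_matrix_def)
  moreover have "(\<Sum>j\<in>UNIV. A $ j $ i) = (\<Sum>k\<in>UNIV. A $ i $ k)"
    using assms by (intro sum.cong) auto
  ultimately show ?thesis
    by (simp add: lazy_walk_def sum.distrib sum_subtractf mat_def flip: sum_divide_distrib)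
qed

lemma norm_uniform_target: "norm (uniform_target :: real^'n) = 1"
proof -
  have "norm (\<chi> i. 1 :: real^'n) = sqrt (real CARD('n))"
    by (simp add: norm_vec_def L2_set_def)
  then show ?thesis by (simp add: uniform_target_def)
qed

lemma normalized_comb_inner_uniform:
  fixes P :: "real^'n^'n"
  assumes "\<And>i. (\<Sum>j\<in>UNIV. P $ j $ i) = 1"
  shows "normalized_comb P w \<bullet> uniform_target
    = (\<Sum>i\<in>UNIV. w $ i / (norm (column i P) * sqrt (real CARD('n))))"
proof -
  have "column i P \<bullet> uniform_target = 1 / sqrt (real CARD('n))" for i
    using assms[of i]
    by (simp add: uniform_target_def inner_vec_def column_def flip: sum_divide_distrib)
  then show ?thesis
    by (simp add: normalized_comb_def inner_sum_left flip: divide_inverse)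
qed

lemma continuous_on_normalized_comb [continuous_intros]:
  "continuous_on S (normalized_comb P)"
  unfolding normalized_comb_def by (intro continuous_intros)

text \<open>The condition \<open>w $ i > 0\<close> is open, so closedness is not immediate.
  Vanishing outside a fixed \<open>S\<close> is a closed condition, however, and only finitely many
  sets \<open>S\<close> with at most \<open>K\<close> vertices occur.\<close>

lemma closed_feasible:
  fixes P :: "real^'n^'n"
  shows "closed (feasible P K)"
proof -
  have eq: "feasible P K = (\<Union>S\<in>{S. card S \<le> K}.
    (\<Inter>i. {w. 0 \<le> w $ i}) \<inter> (\<Inter>i\<in>- S. {w. w $ i = 0}) \<inter> {w. norm (normalized_comb P w) = 1})"
    (is "_ = (\<Union>S\<in>_. ?F S)")
  proof (intro equalityI subsetI)
    fix w assume "w \<in> feasible P K"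
    then have "w \<in> ?F (pos_support w)" "card (pos_support w) \<le> K"
      by (auto simp: feasible_def pos_support_def not_less order.eq_iff)
    then show "w \<in> (\<Union>S\<in>{S. card S \<le> K}. ?F S)" by blast
  next
    fix w assume "w \<in> (\<Union>S\<in>{S. card S \<le> K}. ?F S)"
    then obtain S where S: "card S \<le> K" "w \<in> ?F S" by blast
    then have "pos_support w \<subseteq> S" by (force simp: pos_support_def)
    then have "card (pos_support w) \<le> card S" by (simp add: card_mono)
    then show "w \<in> feasible P K" using S by (auto simp: feasible_def)
  qed
  have closed: "closed (?F S)" for S
    by (intro closed_Int closed_INT ballI closed_Collect_le closed_Collect_eq continuous_intros)
  show ?thesis unfolding eq by (intro closed_UN ballI closed finite)
qed

text \<open>Since the weights are nonnegative, nothing cancels in the linear form: each single term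
  is at most the whole sum, hence at most 1, which bounds every coordinate.\<close>

lemma bounded_feasible:
  fixes P :: "real^'n^'n"
  assumes sums: "\<And>i. (\<Sum>j\<in>UNIV. P $ j $ i) = 1" and pos: "\<And>i. norm (column i P) > 0"
  shows "bounded (feasible P K)"
proof (rule boundedI)
  fix w assume w: "w \<in> feasible P K"
  let ?g = "\<lambda>i. norm (column i P) * sqrt (real CARD('n))"
  have gpos: "?g i > 0" for i using pos by simp
  have "normalized_comb P w \<bullet> uniform_target \<le> 1"
    using norm_cauchy_schwarz[of "normalized_comb P w" uniform_target] w
    by (simp add: norm_uniform_target feasible_def)
  then have le1: "(\<Sum>i\<in>UNIV. w $ i / ?g i) \<le> 1"
    by (simp add: normalized_comb_inner_uniform[OF sums])
  have "w $ i / ?g i \<le> 1" for i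
  proof -
    have "w $ i / ?g i \<le> (\<Sum>i\<in>UNIV. w $ i / ?g i)"
      using w gpos by (intro member_le_sum) (auto simp: feasible_def intro: divide_nonneg_pos)
    with le1 show ?thesis by simp
  qed
  then have "w $ i \<le> ?g i" for i by (simp only: pos_divide_le_eq[OF gpos] mult_1)
  then have "\<bar>w $ i\<bar> \<le> ?g i" for i using w by (simp add: feasible_def)
  then show "norm w \<le> (\<Sum>i\<in>UNIV. ?g i)"
    by (intro order.trans[OF norm_le_l1_cart sum_mono])
qed

text \<open>A single normalized column has length 1. This shows that the feasible set is nonempty
  and provides the test points for a lower bound on the maximum.\<close>

lemma axis_feasible:
  fixes P :: "real^'n^'n"
  assumes "norm (column i P) > 0" "1 \<le> K"
  shows "axis i 1 \<in> feasible P K"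
proof -
  have "pos_support (axis i 1 :: real^'n) = {i}"
    by (auto simp: pos_support_def axis_def)
  moreover have "normalized_comb P (axis i 1) = column i P /\<^sub>R norm (column i P)"
    by (subst normalized_comb_def, subst sum.remove[of _ i]) (auto simp: axis_def)
  ultimately show ?thesis
    using assms by (auto simp: feasible_def axis_def)
qed

theorem theorem1:
  fixes A :: "real^'n^'n" and P :: "real^'n^'n" and K :: nat and \<kappa> lam :: real
    and C :: "'n \<Rightarrow> real" and wstar :: "real^'n"
  assumes A_sym: "\<And>i j. A $ i $ j = A $ j $ i"
    and A_nonneg: "\<And>i j. A $ i $ j \<ge> 0"
    and max_degree_pos: "max_degree A > 0"
    and P_eq: "P = lazy_walk A"
    and K_bounds: "1 \<le> K" "K \<le> CARD('n)"
    and kappa: "0 < \<kappa>" "\<kappa> \<le> 1"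
    and C_nonneg: "\<And>v. C v \<ge> 0"
    and C_max_pos: "sum_largest K C > 0"
    and lam_nonneg: "0 \<le> lam"
    and lam_le: "lam \<le> (1 - \<kappa>) /
      (sum_largest K C * Min (range (\<lambda>i. norm (column i P))) * sqrt (real CARD('n)))"
    and wstar: "is_arg_max
      (\<lambda>w. normalized_comb P w \<bullet> uniform_target - lam * sum C (pos_support w))
      (\<lambda>w. w \<in> feasible P K) wstar"
  shows "\<exists>w0. is_arg_max (\<lambda>w. normalized_comb P w \<bullet> uniform_target)
      (\<lambda>w. w \<in> feasible P K) w0 \<and>
    normalized_comb P wstar \<bullet> uniform_target \<ge>
      \<kappa> * (normalized_comb P w0 \<bullet> uniform_target)"
proof -
  let ?f = "\<lambda>w. normalized_comb P w \<bullet> uniform_target"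
  let ?m = "Min (range (\<lambda>i. norm (column i P)))"
  let ?n = "sqrt (real CARD('n))"
  have sums: "(\<Sum>j\<in>UNIV. P $ j $ i) = 1" for i
    using lazy_walk_column_sum[OF A_sym] P_eq by simp
  have pos: "norm (column i P) > 0" for i
  proof -
    have "column i P \<noteq> 0"
    proof
      assume "column i P = 0"
      then have "P $ j $ i = 0" for j by (simp add: column_def vec_eq_iff)
      then show False using sums[of i] by simp
    qed
    then show ?thesis by simp
  qed
  have "?m \<in> range (\<lambda>i. norm (column i P))"
    by (rule Min_in) auto
  \<comment> \<open>Among the unit coordinate vectors, the one at a column of least norm has the
    largest objective value, and its value matches the bound on \<open>lam\<close>.\<close>
  then obtain i0 where i0: "norm (column i0 P) = ?m"
    by (elim rangeE) (metis (no_types))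
  then have mpos: "?m > 0" using pos[of i0] by simp
  have axis: "axis i0 1 \<in> feasible P K"
    using pos K_bounds by (intro axis_feasible)
  have "compact (feasible P K)"
    using closed_feasible bounded_feasible[OF sums pos] by (simp add: compact_eq_bounded_closed)
  moreover have "continuous_on (feasible P K) ?f"
    by (intro continuous_intros)
  ultimately obtain w0 where w0: "w0 \<in> feasible P K" "\<And>w. w \<in> feasible P K \<Longrightarrow> ?f w \<le> ?f w0"
    using axis continuous_attains_sup[of "feasible P K" ?f] by blast
  have "?f (axis i0 1) = 1 / (?m * ?n)"
    by (simp add: normalized_comb_inner_uniform[OF sums] axis_def i0
        if_distrib[of "\<lambda>c. c / _"] cong: if_cong)
  then have max_ge: "1 / (?m * ?n) \<le> ?f w0"
    using w0(2)[OF axis] by simp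
  have "lam * sum C (pos_support w0) \<le> lam * sum_largest K C"
    using w0(1) C_nonneg lam_nonneg
    by (intro mult_left_mono sum_le_sum_largest) (auto simp: feasible_def)
  also have "\<dots> \<le> (1 - \<kappa>) / (sum_largest K C * ?m * ?n) * sum_largest K C"
    using lam_le C_max_pos by (intro mult_right_mono) auto
  also have "\<dots> = (1 - \<kappa>) * (1 / (?m * ?n))"
    using C_max_pos by simp
  \<comment> \<open>Here \<open>\<kappa> \<le> 1\<close> keeps the factor nonnegative.\<close>
  also have "\<dots> \<le> (1 - \<kappa>) * ?f w0"
    using max_ge kappa by (intro mult_left_mono) auto
  finally have penalty: "lam * sum C (pos_support w0) \<le> (1 - \<kappa>) * ?f w0" .
  have "?f w0 - lam * sum C (pos_support w0) \<le> ?f wstar - lam * sum C (pos_support wstar)"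
    using wstar w0(1) by (auto simp: is_arg_max_linorder)
  moreover have "lam * sum C (pos_support wstar) \<ge> 0"
    using lam_nonneg C_nonneg by (simp add: sum_nonneg)
  ultimately have "\<kappa> * ?f w0 \<le> ?f wstar"
    using penalty by (simp add: algebra_simps)
  moreover have "is_arg_max ?f (\<lambda>w. w \<in> feasible P K) w0"
    using w0 by (simp add: is_arg_max_linorder)
  ultimately show ?thesis by blast
qed

end
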